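(* Let $\mathcal{B}$ be a finite left regular band and $\mathcal{G}$ a presheaf of finite groups on $\mathcal{B}$, and let $\mathcal{S}=\bigsqcup_{x\in\mathcal{B}}\mathcal{G}[x]$ with product $s\cdot t=\Delta_x^{xy}(s)\,\Delta_y^{xy}(t)$ (computed in $\mathcal{G}[xy]$) for $s\in\mathcal{G}[x]$, $t\in\mathcal{G}[y]$. Then $\mathcal{S}$ is a strict left regular band of groups. Furthermore, every strict left regular band of groups arises (up to isomorphism) in this manner.
   Context: A left regular band is a semigroup with $x^2=x$ and $xyx=xy$. On a left regular band $\mathcal{B}$, $x\preceq y$ iff $yx=y$ (a preorder). A presheaf of finite groups on $\mathcal{B}$ assigns a finite group $\mathcal{G}[x]$ to each $x\in\mathcal{B}$ and a group morphism $\Delta_x^y:\mathcal{G}[x]\to\mathcal{G}[y]$ to each pair $x\preceq y$, with $\Delta_x^x=\mathrm{id}$ and $\Delta_y^z\circ\Delta_x^y=\Delta_x^z$ whenever $x\preceq y\preceq z$ (note $x\preceq xy$ and $y\preceq xy$). For $s$ in a finite semigroup, $s^\omega$ is the unique idempotent that is a positive power of $s$. A finite semigroup $\mathcal{S}$ is a left regular band of groups if $s^\omega s=s$ and $sts^\omega=st$ for all $s,t$; it is strict if moreover $(st)^\omega=s^\omega t^\omega$ for all $s,t$. *)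

theory Defs
  imports "HOL-Algebra.Group"
begin

(* HOL-Algebra has no carrier-based semigroups (its monoid record carries a unit). *)
record 'a sgrp = "'a partial_object" +
  sgmult :: "'a \<Rightarrow> 'a \<Rightarrow> 'a" (infixl \<open>\<odot>\<index>\<close> 70)

(* The empty semigroup is admitted. *)
locale carrier_semigroup =
  fixes S :: "('a, 'm) sgrp_scheme" (structure)
  assumes closed: "\<lbrakk>x \<in> carrier S; y \<in> carrier S\<rbrakk> \<Longrightarrow> x \<odot> y \<in> carrier S"
    and assoc: "\<lbrakk>x \<in> carrier S; y \<in> carrier S; z \<in> carrier S\<rbrakk>
      \<Longrightarrow> (x \<odot> y) \<odot> z = x \<odot> (y \<odot> z)"

definition sgrp_iso :: "('a, 'm) sgrp_scheme \<Rightarrow> ('b, 'n) sgrp_scheme \<Rightarrow> ('a \<Rightarrow> 'b) set" where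
  "sgrp_iso S T = {h. bij_betw h (carrier S) (carrier T) \<and>
     (\<forall>s\<in>carrier S. \<forall>t\<in>carrier S. h (s \<odot>\<^bsub>S\<^esub> t) = h s \<odot>\<^bsub>T\<^esub> h t)}"

locale left_regular_band = carrier_semigroup B for B (structure) +
  assumes idem: "x \<in> carrier B \<Longrightarrow> x \<odot> x = x"
    and left_regular: "\<lbrakk>x \<in> carrier B; y \<in> carrier B\<rbrakk> \<Longrightarrow> x \<odot> y \<odot> x = x \<odot> y"

(* Only a preorder in general, not antisymmetric; meant for elements of the carrier. *)
definition lrb_le :: "('a, 'm) sgrp_scheme \<Rightarrow> 'a \<Rightarrow> 'a \<Rightarrow> bool" (infix \<open>\<preceq>\<index>\<close> 50) where
  "x \<preceq>\<^bsub>B\<^esub> y \<longleftrightarrow> y \<odot>\<^bsub>B\<^esub> x = y"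

(* \<Delta> x y is the map from G x to G y; its values matter only for x \<preceq> y in the carrier of B,
   and only on the carrier of G x. *)
locale presheaf_of_finite_groups = left_regular_band B for B (structure) +
  fixes G :: "'a \<Rightarrow> ('g, 'n) monoid_scheme"
    and \<Delta> :: "'a \<Rightarrow> 'a \<Rightarrow> 'g \<Rightarrow> 'g"
  assumes group: "x \<in> carrier B \<Longrightarrow> Group.group (G x)"
    and finite: "x \<in> carrier B \<Longrightarrow> Finite_Set.finite (carrier (G x))"
    and morphism: "\<lbrakk>x \<in> carrier B; y \<in> carrier B; x \<preceq> y\<rbrakk> \<Longrightarrow> \<Delta> x y \<in> hom (G x) (G y)"
    and identity: "\<lbrakk>x \<in> carrier B; s \<in> carrier (G x)\<rbrakk> \<Longrightarrow> \<Delta> x x s = s"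
    and composition: "\<lbrakk>x \<in> carrier B; y \<in> carrier B; z \<in> carrier B; x \<preceq> y; y \<preceq> z;
      s \<in> carrier (G x)\<rbrakk> \<Longrightarrow> \<Delta> y z (\<Delta> x y s) = \<Delta> x z s"

(* The pair (x, s) is the element s of G x in the disjoint union. *)
definition presheaf_semigroup ::
  "('b, 'm) sgrp_scheme \<Rightarrow> ('b \<Rightarrow> ('g, 'n) monoid_scheme) \<Rightarrow> ('b \<Rightarrow> 'b \<Rightarrow> 'g \<Rightarrow> 'g) \<Rightarrow> ('b \<times> 'g) sgrp"
  where "presheaf_semigroup B G \<Delta> =
    \<lparr>carrier = (SIGMA x:carrier B. carrier (G x)),
     sgmult = (\<lambda>(x, s) (y, t). let z = x \<odot>\<^bsub>B\<^esub> y in (z, \<Delta> x z s \<otimes>\<^bsub>G z\<^esub> \<Delta> y z t))\<rparr>"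

(* Exponents are shifted to avoid a unit: sgpow_Suc S s n is s to the power n + 1. *)
primrec sgpow_Suc :: "('a, 'm) sgrp_scheme \<Rightarrow> 'a \<Rightarrow> nat \<Rightarrow> 'a" where
  "sgpow_Suc S s 0 = s"
| "sgpow_Suc S s (Suc n) = sgpow_Suc S s n \<odot>\<^bsub>S\<^esub> s"

(* Meaningful for s in the carrier of a finite semigroup, where this idempotent exists and is
   unique. *)
definition omega :: "('a, 'm) sgrp_scheme \<Rightarrow> 'a \<Rightarrow> 'a" (\<open>\<omega>\<index>\<close>) where
  "omega S s = (THE e. e \<odot>\<^bsub>S\<^esub> e = e \<and> (\<exists>n. e = sgpow_Suc S s n))"

locale left_regular_band_of_groups = carrier_semigroup S for S (structure) +
  assumes finite: "Finite_Set.finite (carrier S)"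
    and omega_left: "s \<in> carrier S \<Longrightarrow> \<omega> s \<odot> s = s"
    and omega_right: "\<lbrakk>s \<in> carrier S; t \<in> carrier S\<rbrakk> \<Longrightarrow> s \<odot> t \<odot> \<omega> s = s \<odot> t"

locale strict_left_regular_band_of_groups = left_regular_band_of_groups +
  assumes omega_mult: "\<lbrakk>s \<in> carrier S; t \<in> carrier S\<rbrakk> \<Longrightarrow> \<omega> (s \<odot> t) = \<omega> s \<odot> \<omega> t"

end

theory Submission
  imports Defs "HOL-Algebra.Multiplicative_Group"
begin

text \<open>
  In the semigroup of a presheaf, the powers of \<open>(x, s)\<close> stay in the fibre over \<open>x\<close>, so that
  \<open>(x, s)\<^sup>\<omega> = (x, 1)\<close>.  Conversely, in a strict left regular band of groups the idempotents form a
  left regular band \<open>B\<close>, the elements \<open>s\<close> with \<open>s\<^sup>\<omega> = e\<close> form a group \<open>G[e]\<close> with unit \<open>e\<close>, and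
  left multiplication by \<open>f\<close> is a morphism from \<open>G[e]\<close> to \<open>G[f]\<close> whenever \<open>e \<preceq> f\<close>.
\<close>

section \<open>Powers and idempotents in a finite semigroup\<close>

context carrier_semigroup
begin

lemma sgpow_Suc_closed: "s \<in> carrier S \<Longrightarrow> sgpow_Suc S s n \<in> carrier S"
  by (induction n) (auto intro: closed)

lemma sgpow_Suc_mult:
  assumes "s \<in> carrier S"
  shows "sgpow_Suc S s m \<odot> sgpow_Suc S s n = sgpow_Suc S s (Suc (m + n))"
  using assms by (induction n) (simp_all add: sgpow_Suc_closed flip: assoc)

text \<open>The index reflects the shift by one: (m + 1)(n + 1) = (m + n + m n) + 1.\<close>

lemma sgpow_Suc_sgpow_Suc:
  assumes "s \<in> carrier S"
  shows "sgpow_Suc S (sgpow_Suc S s m) n = sgpow_Suc S s (m + n + m * n)"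
proof (induction n)
  case (Suc n)
  have "sgpow_Suc S (sgpow_Suc S s m) (Suc n) = sgpow_Suc S s (Suc (m + n + m * n + m))"
    using sgpow_Suc_mult[OF assms] Suc by simp
  also have "Suc (m + n + m * n + m) = m + Suc n + m * Suc n"
    by simp
  finally show ?case .
qed simp

lemma sgpow_Suc_idem: "e \<odot> e = e \<Longrightarrow> sgpow_Suc S e n = e"
  by (induction n) auto

text \<open>An idempotent equals all its powers, so both sides equal the common power of
  \<open>s\<close> with true exponent (m + 1)(n + 1).\<close>

lemma idem_power_unique:
  assumes s: "s \<in> carrier S"
    and "sgpow_Suc S s m \<odot> sgpow_Suc S s m = sgpow_Suc S s m"
    and "sgpow_Suc S s n \<odot> sgpow_Suc S s n = sgpow_Suc S s n"
  shows "sgpow_Suc S s m = sgpow_Suc S s n"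
proof -
  have "sgpow_Suc S s m = sgpow_Suc S s (m + n + m * n)"
    using sgpow_Suc_idem[OF assms(2), of n] sgpow_Suc_sgpow_Suc[OF s, of m n] by simp
  moreover have "sgpow_Suc S s n = sgpow_Suc S s (n + m + n * m)"
    using sgpow_Suc_idem[OF assms(3), of m] sgpow_Suc_sgpow_Suc[OF s, of n m] by simp
  ultimately show ?thesis
    by (simp add: add.commute mult.commute)
qed

text \<open>Uniqueness turns the definite description into a rule: exhibiting one idempotent power
  computes \<open>\<omega>\<close>.\<close>

lemma omega_eqI:
  assumes "s \<in> carrier S" "sgpow_Suc S s n = e" "e \<odot> e = e"
  shows "\<omega> s = e"
  unfolding omega_def using assms by (intro the_equality) (auto dest: idem_power_unique)

lemma omega_idem: "\<lbrakk>e \<in> carrier S; e \<odot> e = e\<rbrakk> \<Longrightarrow> \<omega> e = e"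
  by (rule omega_eqI[where n = 0]) auto

text \<open>By the pigeonhole principle two powers agree, so the powers are eventually periodic. A
  power beyond the preperiod whose true exponent is a multiple of the period is idempotent.\<close>

lemma idem_power_exists:
  assumes fin: "finite (carrier S)" and s: "s \<in> carrier S"
  shows "\<exists>n. sgpow_Suc S s n \<odot> sgpow_Suc S s n = sgpow_Suc S s n"
proof -
  have "\<not> inj (sgpow_Suc S s)"
    using fin s sgpow_Suc_closed by (meson finite_subset finite_imageD image_subsetI infinite_UNIV_nat)
  then obtain i j where "i < j" and eq: "sgpow_Suc S s i = sgpow_Suc S s j"
    by (metis injI linorder_neqE_nat)
  then obtain p where p: "j = i + Suc p"
    by (metis less_imp_add_positive gr0_implies_Suc)
  \<comment> \<open>Multiplying the repeated power by a further power of \<open>s\<close> raises the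
    index by at least one, hence the range \<open>Suc (i + k)\<close>.\<close>
  have shift: "sgpow_Suc S s (Suc (i + k) + Suc p) = sgpow_Suc S s (Suc (i + k))" for k
  proof -
    have "sgpow_Suc S s (Suc (i + k)) = sgpow_Suc S s i \<odot> sgpow_Suc S s k"
      by (rule sgpow_Suc_mult[OF s, symmetric])
    also have "\<dots> = sgpow_Suc S s (Suc (j + k))"
      unfolding eq by (rule sgpow_Suc_mult[OF s])
    also have "Suc (j + k) = Suc (i + k) + Suc p"
      using p by simp
    finally show ?thesis ..
  qed
  have shifts: "sgpow_Suc S s (Suc (i + k) + r * Suc p) = sgpow_Suc S s (Suc (i + k))" for k r
  proof (induction r)
    case (Suc r)
    then show ?case
      using shift[of "k + r * Suc p"] by (simp add: algebra_simps del: sgpow_Suc.simps)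
  qed simp
  \<comment> \<open>The true exponent \<open>Suc n\<close> is a multiple of the period
    \<open>Suc p\<close>, and the factor \<open>i + 2\<close> makes \<open>n\<close> at least
    \<open>Suc i\<close>, inside the periodic range.\<close>
  define n where "n = (i + 2) * Suc p - 1"
  have n: "Suc n = (i + 2) * Suc p"
    by (simp add: n_def)
  then obtain k where k: "n = Suc (i + k)"
    by (metis Suc_le_mono add_2_eq_Suc' add_Suc le_Suc_ex le_add1 mult_Suc_right)
  have "sgpow_Suc S s n \<odot> sgpow_Suc S s n = sgpow_Suc S s (n + Suc n)"
    by (simp add: sgpow_Suc_mult[OF s] del: sgpow_Suc.simps)
  also have "\<dots> = sgpow_Suc S s n"
    using shifts[of k "i + 2"] unfolding k[symmetric] n[symmetric] .
  finally show ?thesis by blast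
qed

lemma omega_power_idem:
  assumes "finite (carrier S)" "s \<in> carrier S"
  shows "\<omega> s \<odot> \<omega> s = \<omega> s" and "\<exists>n. sgpow_Suc S s n = \<omega> s"
  using idem_power_exists[OF assms] omega_eqI[OF assms(2)] by metis+

end

section \<open>From a presheaf of groups to a strict left regular band of groups\<close>

context presheaf_of_finite_groups
begin

lemma le_mult_left: "\<lbrakk>x \<in> carrier B; y \<in> carrier B\<rbrakk> \<Longrightarrow> x \<preceq> x \<odot> y"
  by (simp add: lrb_le_def left_regular)

lemma le_mult_right: "\<lbrakk>x \<in> carrier B; y \<in> carrier B\<rbrakk> \<Longrightarrow> y \<preceq> x \<odot> y"
  by (simp add: lrb_le_def assoc idem)

lemma morphism_closed:
  "\<lbrakk>x \<in> carrier B; y \<in> carrier B; x \<preceq> y; s \<in> carrier (G x)\<rbrakk> \<Longrightarrow> \<Delta> x y s \<in> carrier (G y)"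
  using morphism by (meson hom_in_carrier)

lemma morphism_mult:
  "\<lbrakk>x \<in> carrier B; y \<in> carrier B; x \<preceq> y; s \<in> carrier (G x); t \<in> carrier (G x)\<rbrakk>
    \<Longrightarrow> \<Delta> x y (s \<otimes>\<^bsub>G x\<^esub> t) = \<Delta> x y s \<otimes>\<^bsub>G y\<^esub> \<Delta> x y t"
  using morphism by (meson hom_mult)

lemma morphism_one: "\<lbrakk>x \<in> carrier B; y \<in> carrier B; x \<preceq> y\<rbrakk> \<Longrightarrow> \<Delta> x y \<one>\<^bsub>G x\<^esub> = \<one>\<^bsub>G y\<^esub>"
  using morphism group by (meson hom_one)

abbreviation P where "P \<equiv> presheaf_semigroup B G \<Delta>"

lemma carrier_P: "(x, s) \<in> carrier P \<longleftrightarrow> x \<in> carrier B \<and> s \<in> carrier (G x)"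
  by (simp add: presheaf_semigroup_def)

lemma mult_P:
  "(x, s) \<odot>\<^bsub>P\<^esub> (y, t) = (x \<odot> y, \<Delta> x (x \<odot> y) s \<otimes>\<^bsub>G (x \<odot> y)\<^esub> \<Delta> y (x \<odot> y) t)"
  by (simp add: presheaf_semigroup_def Let_def)

text \<open>For associativity, functoriality transports all three factors into the single group over
  \<open>x \<odot> y \<odot> z\<close>, where both bracketings agree.\<close>

lemma presheaf_carrier_semigroup: "carrier_semigroup P"
proof
  fix a b
  assume "a \<in> carrier P" "b \<in> carrier P"
  then show "a \<odot>\<^bsub>P\<^esub> b \<in> carrier P"
    by (cases a; cases b)
      (auto simp: carrier_P mult_P closed le_mult_left le_mult_right
        intro!: monoid.m_closed[OF group.is_monoid] group morphism_closed)
next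
  fix a b c
  assume "a \<in> carrier P" "b \<in> carrier P" "c \<in> carrier P"
  moreover obtain x s y t z u where abc: "a = (x, s)" "b = (y, t)" "c = (z, u)"
    by (metis surj_pair)
  ultimately have x: "x \<in> carrier B" "s \<in> carrier (G x)" and y: "y \<in> carrier B" "t \<in> carrier (G y)"
    and z: "z \<in> carrier B" "u \<in> carrier (G z)"
    by (auto simp: carrier_P)
  define w where "w = x \<odot> y \<odot> z"
  have w': "x \<odot> (y \<odot> z) = w"
    using x y z by (simp add: w_def assoc)
  have B: "x \<odot> y \<in> carrier B" "y \<odot> z \<in> carrier B" "w \<in> carrier B"
    using x y z by (auto simp: w_def closed)
  have le: "x \<odot> y \<preceq> w" "y \<odot> z \<preceq> w" "x \<preceq> w" "z \<preceq> w"
    using le_mult_left[of "x \<odot> y" z] le_mult_right[of x "y \<odot> z"] le_mult_left[of x "y \<odot> z"]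
      le_mult_right[of "x \<odot> y" z] x y z B by (auto simp: w' simp flip: w_def)
  \<comment> \<open>The middle factor needs transitivity through \<open>y \<odot> z\<close>: w y = w
    (y z) y = w (y z) = w.\<close>
  have "y \<preceq> w"
    unfolding lrb_le_def
    by (metis B(2,3) assoc le(2) le_mult_left lrb_le_def y(1) z(1))
  interpret Gw: group "G w"
    using B group by blast
  note cl = morphism_closed le B x y z le_mult_left le_mult_right \<open>y \<preceq> w\<close>
  have "a \<odot>\<^bsub>P\<^esub> b \<odot>\<^bsub>P\<^esub> c = (w, (\<Delta> x w s \<otimes>\<^bsub>G w\<^esub> \<Delta> y w t) \<otimes>\<^bsub>G w\<^esub> \<Delta> z w u)"
    by (simp add: abc mult_P morphism_mult composition cl flip: w_def)
  also have "\<dots> = (w, \<Delta> x w s \<otimes>\<^bsub>G w\<^esub> (\<Delta> y w t \<otimes>\<^bsub>G w\<^esub> \<Delta> z w u))"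
    by (simp add: Gw.m_assoc cl)
  also have "\<dots> = a \<odot>\<^bsub>P\<^esub> (b \<odot>\<^bsub>P\<^esub> c)"
    by (simp add: abc mult_P w' morphism_mult composition cl)
  finally show "a \<odot>\<^bsub>P\<^esub> b \<odot>\<^bsub>P\<^esub> c = a \<odot>\<^bsub>P\<^esub> (b \<odot>\<^bsub>P\<^esub> c)" .
qed

lemma sgpow_Suc_presheaf:
  assumes "x \<in> carrier B" "s \<in> carrier (G x)"
  shows "sgpow_Suc P (x, s) n = (x, s [^]\<^bsub>G x\<^esub> Suc n)"
proof -
  interpret Gx: group "G x"
    using assms group by blast
  show ?thesis
    using assms by (induction n) (simp_all add: mult_P idem identity)
qed

lemma omega_presheaf:
  assumes "x \<in> carrier B" "s \<in> carrier (G x)"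
  shows "\<omega>\<^bsub>P\<^esub> (x, s) = (x, \<one>\<^bsub>G x\<^esub>)"
proof -
  interpret carrier_semigroup P
    by (rule presheaf_carrier_semigroup)
  interpret Gx: group "G x"
    using assms group by blast
  have "order (G x) > 0"
    using finite assms Gx.order_gt_0_iff_finite by blast
  \<comment> \<open>Lagrange: \<open>s\<close> to the order of \<open>G x\<close> is the unit. The
    order is positive, so the shifted index is one less.\<close>
  then have "sgpow_Suc P (x, s) (order (G x) - 1) = (x, \<one>\<^bsub>G x\<^esub>)"
    using assms by (simp add: sgpow_Suc_presheaf Gx.pow_order_eq_1 del: Gx.nat_pow_Suc)
  then show ?thesis
    using assms by (intro omega_eqI) (auto simp: carrier_P mult_P idem identity)
qed

text \<open>Since \<open>\<omega>\<close> yields the unit of each fibre and morphisms preserve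
  units, the laws reduce to unit laws in the groups and x y x = x y in the band.\<close>

lemma presheaf_strict:
  assumes "finite (carrier B)"
  shows "strict_left_regular_band_of_groups P"
proof -
  interpret P: carrier_semigroup P
    by (rule presheaf_carrier_semigroup)
  show ?thesis
  proof
    show "finite (carrier P)"
      using assms finite by (simp add: presheaf_semigroup_def)
  next
    fix a
    assume "a \<in> carrier P"
    then show "\<omega>\<^bsub>P\<^esub> a \<odot>\<^bsub>P\<^esub> a = a"
      by (cases a)
        (auto simp: carrier_P omega_presheaf mult_P idem identity group.is_monoid[OF group]
          monoid.l_one monoid.one_closed)
  next
    fix a b
    assume ab: "a \<in> carrier P" "b \<in> carrier P"
    moreover obtain x s y t where eq: "a = (x, s)" "b = (y, t)"
      by (metis surj_pair)
    ultimately have x: "x \<in> carrier B" "s \<in> carrier (G x)"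
      and y: "y \<in> carrier B" "t \<in> carrier (G y)"
      by (auto simp: carrier_P)
    have xy: "x \<odot> y \<in> carrier B"
      using x y closed by blast
    interpret Gxy: group "G (x \<odot> y)"
      using xy group by blast
    note simps = eq mult_P left_regular x y xy identity morphism_one morphism_closed
      le_mult_left le_mult_right omega_presheaf
    show "a \<odot>\<^bsub>P\<^esub> b \<odot>\<^bsub>P\<^esub> \<omega>\<^bsub>P\<^esub> a = a \<odot>\<^bsub>P\<^esub> b"
      by (simp add: simps)
    show "\<omega>\<^bsub>P\<^esub> (a \<odot>\<^bsub>P\<^esub> b) = \<omega>\<^bsub>P\<^esub> a \<odot>\<^bsub>P\<^esub> \<omega>\<^bsub>P\<^esub> b"
      by (simp add: simps)
  qed
qed

end

section \<open>From a strict left regular band of groups back to a presheaf\<close>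

context strict_left_regular_band_of_groups
begin

definition idempotents :: "'a sgrp" where
  "idempotents = \<lparr>carrier = {e \<in> carrier S. e \<odot> e = e}, sgmult = (\<odot>)\<rparr>"

definition fibre :: "'a \<Rightarrow> 'a monoid" where
  "fibre e = \<lparr>carrier = {s \<in> carrier S. \<omega> s = e}, monoid.mult = (\<odot>), one = e\<rparr>"

lemma omega_idempotent: "s \<in> carrier S \<Longrightarrow> \<omega> s \<odot> \<omega> s = \<omega> s"
  using omega_power_idem(1)[OF finite] .

lemma omega_power: "s \<in> carrier S \<Longrightarrow> \<exists>n. sgpow_Suc S s n = \<omega> s"
  using omega_power_idem(2)[OF finite] .

lemma omega_closed: "s \<in> carrier S \<Longrightarrow> \<omega> s \<in> carrier S"
  using omega_power sgpow_Suc_closed by metis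

text \<open>Idempotents are their own \<open>\<omega>\<close>, so strictness gives
  \<open>e \<odot> f = \<omega> (e \<odot> f)\<close>, which is idempotent.\<close>

lemma idempotents_mult:
  assumes "e \<in> carrier S" "e \<odot> e = e" "f \<in> carrier S" "f \<odot> f = f"
  shows "(e \<odot> f) \<odot> (e \<odot> f) = e \<odot> f"
  using assms omega_mult[of e f] omega_idempotent[of "e \<odot> f"] by (simp add: omega_idem closed)

lemma idem_right: "\<lbrakk>e \<in> carrier S; e \<odot> e = e; s \<in> carrier S\<rbrakk> \<Longrightarrow> e \<odot> s \<odot> e = e \<odot> s"
  using omega_right[of e s] by (simp add: omega_idem)

lemma left_regular_band_idempotents: "left_regular_band idempotents"
  by unfold_locales
    (auto simp: idempotents_def closed assoc[symmetric] idem_right,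
     auto simp: idempotents_mult closed assoc)

text \<open>By strictness each fibre is closed under powers, which is what places inverses in
  it.\<close>

lemma omega_sgpow_Suc:
  assumes "s \<in> carrier S"
  shows "\<omega> (sgpow_Suc S s n) = \<omega> s"
  using assms by (induction n) (auto simp: omega_mult sgpow_Suc_closed omega_idempotent)

lemma group_fibre:
  assumes e: "e \<in> carrier S" "e \<odot> e = e"
  shows "group (fibre e)"
proof (rule groupI)
  fix s
  assume "s \<in> carrier (fibre e)"
  then have s: "s \<in> carrier S" "\<omega> s = e"
    by (auto simp: fibre_def)
  show "\<one>\<^bsub>fibre e\<^esub> \<otimes>\<^bsub>fibre e\<^esub> s = s"
    using omega_left[of s] s by (simp add: fibre_def)
  obtain n where n: "sgpow_Suc S s n = e"
    using omega_power s by blast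
  show "\<exists>t\<in>carrier (fibre e). t \<otimes>\<^bsub>fibre e\<^esub> s = \<one>\<^bsub>fibre e\<^esub>"
  \<comment> \<open>The inverse is the power just before \<open>e\<close>; for \<open>n = 0\<close>
    there is none, but then \<open>s\<close> is \<open>e\<close> itself.\<close>
  proof (cases n)
    case 0
    with n s e show ?thesis
      by (auto simp: fibre_def)
  next
    case (Suc m)
    then have "sgpow_Suc S s m \<odot> s = e" "sgpow_Suc S s m \<in> carrier (fibre e)"
      using n s by (auto simp: fibre_def omega_sgpow_Suc sgpow_Suc_closed)
    then show ?thesis
      by (auto simp: fibre_def)
  qed
qed (use e in \<open>auto simp: fibre_def closed assoc omega_mult omega_idem\<close>)

lemma presheaf_fibre: "presheaf_of_finite_groups idempotents fibre (\<lambda>e f s. f \<odot> s)"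
proof (intro presheaf_of_finite_groups.intro presheaf_of_finite_groups_axioms.intro
    left_regular_band_idempotents)
  fix e
  assume "e \<in> carrier idempotents"
  then show "group (fibre e)"
    by (auto simp: idempotents_def group_fibre)
  show "finite (carrier (fibre e))"
    using finite by (simp add: fibre_def)
next
  fix e s
  assume "e \<in> carrier idempotents" "s \<in> carrier (fibre e)"
  then show "e \<odot> s = s"
    using omega_left[of s] by (auto simp: fibre_def)
next
  fix e f
  assume "e \<in> carrier idempotents" "f \<in> carrier idempotents" "e \<preceq>\<^bsub>idempotents\<^esub> f"
  then have f: "f \<in> carrier S" "f \<odot> f = f" "f \<odot> e = f"
    by (auto simp: idempotents_def lrb_le_def)
  \<comment> \<open>The inner \<open>f\<close> is absorbed because f s f = f s.\<close>
  have "f \<odot> (s \<odot> t) = f \<odot> s \<odot> (f \<odot> t)" if "s \<in> carrier S" "t \<in> carrier S" for s t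
    using that f by (simp add: idem_right closed flip: assoc)
  \<comment> \<open>Values lie in the right fibre by strictness:
    \<open>\<omega> (f \<odot> s) = f \<odot> e = f\<close>.\<close>
  then show "(\<odot>) f \<in> hom (fibre e) (fibre f)"
    using f by (auto simp: hom_def fibre_def closed omega_mult omega_idem)
next
  fix e f g s
  assume "f \<in> carrier idempotents" "g \<in> carrier idempotents"
    "f \<preceq>\<^bsub>idempotents\<^esub> g" "s \<in> carrier (fibre e)"
  then show "g \<odot> (f \<odot> s) = g \<odot> s"
    by (auto simp: idempotents_def lrb_le_def fibre_def simp flip: assoc)
qed

text \<open>The left side is the product of \<open>(e, s)\<close> and \<open>(f, t)\<close> in the
  presheaf semigroup. The inner \<open>e \<odot> f\<close> is absorbed on the right of
  \<open>s\<close>; the outer one is \<open>\<omega> (s \<odot> t)\<close>, a left unit for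
  \<open>s \<odot> t\<close>.\<close>

lemma mult_fibres:
  assumes s: "s \<in> carrier S" and t: "t \<in> carrier S"
  defines "e \<equiv> \<omega> s" and "f \<equiv> \<omega> t"
  shows "(e \<odot> f \<odot> s) \<odot> (e \<odot> f \<odot> t) = s \<odot> t"
proof -
  have ef: "e \<in> carrier S" "e \<odot> e = e" "f \<in> carrier S" "f \<odot> f = f"
    using s t by (auto simp: e_def f_def omega_closed omega_idempotent)
  then have "(e \<odot> f \<odot> s) \<odot> (e \<odot> f \<odot> t) = (e \<odot> f) \<odot> s \<odot> (e \<odot> f) \<odot> t"
    using s t by (simp add: closed assoc)
  also have "\<dots> = (e \<odot> f) \<odot> s \<odot> t"
    using s idempotents_mult ef idem_right[of "e \<odot> f" s] by (simp add: closed)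
  also have "\<dots> = \<omega> (s \<odot> t) \<odot> (s \<odot> t)"
    using s t ef by (simp add: omega_mult closed assoc flip: e_def f_def)
  also have "\<dots> = s \<odot> t"
    using s t by (simp add: omega_left closed)
  finally show ?thesis .
qed

lemma snd_iso: "snd \<in> sgrp_iso (presheaf_semigroup idempotents fibre (\<lambda>e f s. f \<odot> s)) S"
proof -
  let ?P = "presheaf_semigroup idempotents fibre (\<lambda>e f s. f \<odot> s)"
  \<comment> \<open>Each \<open>s\<close> lies in exactly one fibre, the one over
    \<open>\<omega> s\<close>, so forgetting the label is bijective.\<close>
  have carrier: "carrier ?P = (\<lambda>s. (\<omega> s, s)) ` carrier S"
    by (auto simp: presheaf_semigroup_def idempotents_def fibre_def omega_closed omega_idempotent)
  have "bij_betw snd (carrier ?P) (carrier S)"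
    unfolding carrier by (auto simp: bij_betw_def inj_on_def image_image)
  moreover have "snd (p \<odot>\<^bsub>?P\<^esub> q) = snd p \<odot> snd q" if "p \<in> carrier ?P" "q \<in> carrier ?P" for p q
    using that unfolding carrier
    by (auto simp: presheaf_semigroup_def idempotents_def fibre_def Let_def mult_fibres)
  ultimately show ?thesis
    by (simp add: sgrp_iso_def)
qed

lemma finite_idempotents: "finite (carrier idempotents)"
  using finite by (simp add: idempotents_def)

end

theorem theoremA16:
  shows "(\<forall>(B :: 'b sgrp) (G :: 'b \<Rightarrow> 'g monoid) \<Delta>.
            left_regular_band B \<and> finite (carrier B) \<and> presheaf_of_finite_groups B G \<Delta> \<longrightarrow>
            strict_left_regular_band_of_groups (presheaf_semigroup B G \<Delta>)) \<and>
         (\<forall>S :: 'a sgrp. strict_left_regular_band_of_groups S \<longrightarrow>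
            (\<exists>(B :: 'a sgrp) (G :: 'a \<Rightarrow> 'a monoid) \<Delta>.
               left_regular_band B \<and> finite (carrier B) \<and> presheaf_of_finite_groups B G \<Delta> \<and>
               sgrp_iso (presheaf_semigroup B G \<Delta>) S \<noteq> {}))"
proof (intro conjI allI impI)
  fix S :: "'a sgrp"
  assume "strict_left_regular_band_of_groups S"
  then interpret strict_left_regular_band_of_groups S .
  show "\<exists>(B :: 'a sgrp) (G :: 'a \<Rightarrow> 'a monoid) \<Delta>.
      left_regular_band B \<and> finite (carrier B) \<and> presheaf_of_finite_groups B G \<Delta> \<and>
      sgrp_iso (presheaf_semigroup B G \<Delta>) S \<noteq> {}"
    using left_regular_band_idempotents finite_idempotents presheaf_fibre snd_iso by blast
qed (blast intro: presheaf_of_finite_groups.presheaf_strict)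

end
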